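(* Let $\alpha\in\mathbb{R}\setminus\{0\}$, $\beta>0$ and let $\mathbf{X}\in\mathbb{T}_{\alpha\beta}^{p\times p}$ be written as $\mathbf{X}=\mathbf{X}_s\mathrm{w}_1+\mathbf{X}_d\mathrm{w}_2$ with $\mathbf{X}_s,\mathbf{X}_d\in\mathbb{C}_\alpha^{p\times p}$. Then $\mathbf{X}$ is invertible (in $\mathbb{T}_{\alpha\beta}^{p\times p}$) if and only if $\mathbf{X}_s$ and $\mathbf{X}_d$ are both invertible (in $\mathbb{C}_\alpha^{p\times p}$). Moreover, if $\mathbf{X}$ is invertible, its inverse is $$\mathbf{X}^{-1}=\mathbf{C}+\mathbf{D}\mathrm{j},\qquad \mathbf{C}=\frac{\mathbf{X}_s^{-1}+\mathbf{X}_d^{-1}}{2},\qquad \mathbf{D}=\frac{\mathbf{X}_s^{-1}-\mathbf{C}}{\sqrt{\beta}}.$$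
   Context: $\mathbb{T}_{\alpha\beta}$ (the $(\alpha\beta)$-tessarines) is the commutative, associative real algebra with basis $1,\mathrm{i},\mathrm{j},\mathrm{k}$ and multiplication $\mathrm{i}^2=\alpha$, $\mathrm{j}^2=\beta$, $\mathrm{k}^2=\alpha\beta$, $\mathrm{i}\mathrm{j}=\mathrm{k}$, $\mathrm{i}\mathrm{k}=\alpha\mathrm{j}$, $\mathrm{j}\mathrm{k}=\beta\mathrm{i}$. $\mathbb{C}_\alpha=\{a+b\mathrm{i}: a,b\in\mathbb{R}\}$ is the subalgebra of $(\alpha)$-complex numbers. Put $\mathrm{w}_1=\frac{\sqrt\beta+\mathrm{j}}{2\sqrt\beta}$ and $\mathrm{w}_2=\frac{\sqrt\beta-\mathrm{j}}{2\sqrt\beta}$. A matrix $\mathbf{X}=\mathbf{A}+\mathbf{B}\mathrm{i}+\mathbf{C}\mathrm{j}+\mathbf{D}\mathrm{k}$ with real $\mathbf{A},\mathbf{B},\mathbf{C},\mathbf{D}$ is written $\mathbf{X}=\mathbf{X}_a+\mathbf{X}_b\mathrm{j}=\mathbf{X}_s\mathrm{w}_1+\mathbf{X}_d\mathrm{w}_2$, where $\mathbf{X}_a=\mathbf{A}+\mathbf{B}\mathrm{i}$, $\mathbf{X}_b=\mathbf{C}+\mathbf{D}\mathrm{i}$, $\mathbf{X}_s=\mathbf{X}_a+\sqrt\beta\,\mathbf{X}_b$, $\mathbf{X}_d=\mathbf{X}_a-\sqrt\beta\,\mathbf{X}_b$. *)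

theory Defs
  imports "HOL-Analysis.Analysis" "HOL-Algebra.Subrings"
begin

datatype tessarine = Tess (re: real) (im_i: real) (im_j: real) (im_k: real)

text \<open>The vector space structure and the unit do not depend on the parameters, so they are given by
  type class instances. Only the multiplication depends on \<open>\<alpha>\<close> and \<open>\<beta>\<close>.\<close>

instantiation tessarine :: "{real_vector, one}"
begin

definition "0 = Tess 0 0 0 0"
definition "1 = Tess 1 0 0 0"
definition "x + y = Tess (re x + re y) (im_i x + im_i y) (im_j x + im_j y) (im_k x + im_k y)"
definition "- x = Tess (- re x) (- im_i x) (- im_j x) (- im_k x)"
definition "x - y = Tess (re x - re y) (im_i x - im_i y) (im_j x - im_j y) (im_k x - im_k y)"
definition "r *\<^sub>R x = Tess (r * re x) (r * im_i x) (r * im_j x) (r * im_k x)"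

instance
  by standard
    (simp_all add: zero_tessarine_def plus_tessarine_def uminus_tessarine_def
      minus_tessarine_def scaleR_tessarine_def algebra_simps)

end

lemmas tess_defs = zero_tessarine_def one_tessarine_def plus_tessarine_def uminus_tessarine_def
  minus_tessarine_def scaleR_tessarine_def

definition tess_i :: tessarine where "tess_i = Tess 0 1 0 0"
definition tess_j :: tessarine where "tess_j = Tess 0 0 1 0"
definition tess_k :: tessarine where "tess_k = Tess 0 0 0 1"

text \<open>The bilinear extension of the multiplication table proved in \<open>tess_mult_table\<close>.\<close>

definition tess_mult :: "real \<Rightarrow> real \<Rightarrow> tessarine \<Rightarrow> tessarine \<Rightarrow> tessarine" where
  "tess_mult \<alpha> \<beta> x y = Tess
     (re x * re y + \<alpha> * im_i x * im_i y + \<beta> * im_j x * im_j y + \<alpha> * \<beta> * im_k x * im_k y)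
     (re x * im_i y + im_i x * re y + \<beta> * (im_j x * im_k y + im_k x * im_j y))
     (re x * im_j y + im_j x * re y + \<alpha> * (im_i x * im_k y + im_k x * im_i y))
     (re x * im_k y + im_k x * re y + im_i x * im_j y + im_j x * im_i y)"

lemma tess_mult_table:
  "tess_mult \<alpha> \<beta> tess_i tess_i = \<alpha> *\<^sub>R 1"
  "tess_mult \<alpha> \<beta> tess_j tess_j = \<beta> *\<^sub>R 1"
  "tess_mult \<alpha> \<beta> tess_k tess_k = (\<alpha> * \<beta>) *\<^sub>R 1"
  "tess_mult \<alpha> \<beta> tess_i tess_j = tess_k"
  "tess_mult \<alpha> \<beta> tess_i tess_k = \<alpha> *\<^sub>R tess_j"
  "tess_mult \<alpha> \<beta> tess_j tess_k = \<beta> *\<^sub>R tess_i"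
  by (simp_all add: tess_mult_def tess_i_def tess_j_def tess_k_def tess_defs)

definition tessarines :: "real \<Rightarrow> real \<Rightarrow> tessarine ring" where
  "tessarines \<alpha> \<beta> =
     \<lparr>carrier = UNIV, mult = tess_mult \<alpha> \<beta>, one = 1, ring.zero = 0, add = (+)\<rparr>"

text \<open>The subalgebra of \<open>\<alpha>\<close>-complex numbers \<open>a + b i\<close>; its multiplication does not
  depend on \<open>\<beta>\<close>.\<close>

definition alpha_complex :: "real \<Rightarrow> real \<Rightarrow> tessarine ring" where
  "alpha_complex \<alpha> \<beta> = tessarines \<alpha> \<beta> \<lparr>carrier := {a *\<^sub>R 1 + b *\<^sub>R tess_i |a b. True}\<rparr>"

lemma carrier_alpha_complex: "carrier (alpha_complex \<alpha> \<beta>) = {x. im_j x = 0 \<and> im_k x = 0}"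
proof -
  have "\<exists>a b. x = Tess a b 0 0" if "im_j x = 0" "im_k x = 0" for x
    using that by (cases x) auto
  then show ?thesis by (auto simp: alpha_complex_def tess_i_def tess_defs)
qed

lemma cring_tessarines: "cring (tessarines \<alpha> \<beta>)"
proof (rule cringI)
  have "\<exists>y. y + x = 0" for x :: tessarine
    by (rule exI[of _ "- x"]) simp
  then show "abelian_group (tessarines \<alpha> \<beta>)"
    by (intro abelian_groupI) (auto simp: tessarines_def add_ac)
  show "Group.comm_monoid (tessarines \<alpha> \<beta>)"
    by (intro comm_monoidI) (auto simp: tessarines_def tess_mult_def tess_defs algebra_simps)
qed (auto simp: tessarines_def tess_mult_def tess_defs algebra_simps)

lemma subcring_alpha_complex: "subcring (carrier (alpha_complex \<alpha> \<beta>)) (tessarines \<alpha> \<beta>)"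
proof (rule ring.subcringI[OF cring.axioms(1)[OF cring_tessarines]])
  interpret T: cring "tessarines \<alpha> \<beta>" by (rule cring_tessarines)
  have m: "\<ominus>\<^bsub>tessarines \<alpha> \<beta>\<^esub> x = - x" for x
    by (rule T.minus_equality) (auto simp: tessarines_def)
  show "subring (carrier (alpha_complex \<alpha> \<beta>)) (tessarines \<alpha> \<beta>)"
    by (rule T.subringI) (auto simp: carrier_alpha_complex m, auto simp: tessarines_def tess_mult_def tess_defs)
qed (simp add: tessarines_def tess_mult_def mult.commute)

definition mat_ring :: "('a, 'm) ring_scheme \<Rightarrow> ('a ^ 'p ^ 'p) ring" where
  "mat_ring R =
     \<lparr>carrier = {A. \<forall>i j. A $ i $ j \<in> carrier R},
      mult = (\<lambda>A B. \<chi> i j. \<Oplus>\<^bsub>R\<^esub>k\<in>UNIV. A $ i $ k \<otimes>\<^bsub>R\<^esub> B $ k $ j),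
      one = (\<chi> i j. if i = j then \<one>\<^bsub>R\<^esub> else \<zero>\<^bsub>R\<^esub>),
      ring.zero = (\<chi> i j. \<zero>\<^bsub>R\<^esub>),
      add = (\<lambda>A B. \<chi> i j. A $ i $ j \<oplus>\<^bsub>R\<^esub> B $ i $ j)\<rparr>"

definition mat_smult :: "('a, 'm) ring_scheme \<Rightarrow> 'a ^ 'p ^ 'p \<Rightarrow> 'a \<Rightarrow> 'a ^ 'p ^ 'p" where
  "mat_smult R A t = (\<chi> i j. A $ i $ j \<otimes>\<^bsub>R\<^esub> t)"

definition w1 :: "real \<Rightarrow> tessarine" where
  "w1 \<beta> = (1 / (2 * sqrt \<beta>)) *\<^sub>R (sqrt \<beta> *\<^sub>R 1 + tess_j)"

definition w2 :: "real \<Rightarrow> tessarine" where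
  "w2 \<beta> = (1 / (2 * sqrt \<beta>)) *\<^sub>R (sqrt \<beta> *\<^sub>R 1 - tess_j)"

text \<open>The components in \<open>X = X\<^sub>a + X\<^sub>b j\<close>.\<close>

definition part_a :: "tessarine ^ 'p ^ 'p \<Rightarrow> tessarine ^ 'p ^ 'p" where
  "part_a X = (\<chi> r c. re (X $ r $ c) *\<^sub>R 1 + im_i (X $ r $ c) *\<^sub>R tess_i)"

definition part_b :: "tessarine ^ 'p ^ 'p \<Rightarrow> tessarine ^ 'p ^ 'p" where
  "part_b X = (\<chi> r c. im_j (X $ r $ c) *\<^sub>R 1 + im_k (X $ r $ c) *\<^sub>R tess_i)"

lemma part_a_b_decomposition:
  "X = part_a X + mat_smult (tessarines \<alpha> \<beta>) (part_b X) tess_j"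
  by (simp add: vec_eq_iff part_a_def part_b_def mat_smult_def tessarines_def tess_mult_def
      tess_i_def tess_j_def tess_defs)

text \<open>Every matrix has exactly one decomposition with respect to \<open>w1\<close> and \<open>w2\<close>.\<close>

lemma w_decomposition_iff:
  fixes X Xs Xd :: "tessarine ^ 'p ^ 'p"
  assumes "\<beta> > 0"
    and "Xs \<in> carrier (mat_ring (alpha_complex \<alpha> \<beta>))"
    and "Xd \<in> carrier (mat_ring (alpha_complex \<alpha> \<beta>))"
  shows "X = mat_smult (tessarines \<alpha> \<beta>) Xs (w1 \<beta>) + mat_smult (tessarines \<alpha> \<beta>) Xd (w2 \<beta>) \<longleftrightarrow>
         Xs = part_a X + sqrt \<beta> *\<^sub>R part_b X \<and> Xd = part_a X - sqrt \<beta> *\<^sub>R part_b X"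
proof -
  have C: "im_j (Xs $ r $ c) = 0" "im_k (Xs $ r $ c) = 0"
    "im_j (Xd $ r $ c) = 0" "im_k (Xd $ r $ c) = 0" for r c
    using assms(2,3) by (auto simp: mat_ring_def carrier_alpha_complex)
  have s: "sqrt \<beta> \<noteq> 0" using assms(1) by simp
  have "X $ r $ c = tess_mult \<alpha> \<beta> (Xs $ r $ c) (w1 \<beta>) + tess_mult \<alpha> \<beta> (Xd $ r $ c) (w2 \<beta>) \<longleftrightarrow>
        Xs $ r $ c = part_a X $ r $ c + sqrt \<beta> *\<^sub>R part_b X $ r $ c \<and>
        Xd $ r $ c = part_a X $ r $ c - sqrt \<beta> *\<^sub>R part_b X $ r $ c" for r c
    using C[of r c] s
    by (cases "X $ r $ c"; cases "Xs $ r $ c"; cases "Xd $ r $ c")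
      (auto simp: part_a_def part_b_def tess_mult_def w1_def w2_def tess_i_def tess_j_def tess_defs
        field_simps)
  then show ?thesis
    by (simp add: vec_eq_iff mat_smult_def tessarines_def) blast
qed

lemma w_decomposition_carrier:
  "part_a X + r *\<^sub>R part_b X \<in> carrier (mat_ring (alpha_complex \<alpha> \<beta>))"
  "part_a X - r *\<^sub>R part_b X \<in> carrier (mat_ring (alpha_complex \<alpha> \<beta>))"
  by (simp_all add: mat_ring_def carrier_alpha_complex part_a_def part_b_def tess_i_def tess_defs)

end

theory Submission
  imports Defs
begin

text \<open>Sending \<open>j\<close> to \<open>\<plusminus>\<surd>\<beta>\<close> gives two ring homomorphisms from the tessarines onto the
  \<open>\<alpha>\<close>-complex numbers. They are jointly injective, and entrywise they map \<open>X\<close> to \<open>X\<^sub>s\<close> and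
  \<open>X\<^sub>d\<close>. So units go to units, and a matrix whose two images are the inverses of \<open>X\<^sub>s\<close> and \<open>X\<^sub>d\<close>
  is an inverse of \<open>X\<close>; the matrix \<open>C + D j\<close> is chosen to have these images.\<close>

text \<open>Induction on \<open>A\<close>, where splitting off one row is additivity of the sum over
  \<open>B\<close>. It serves the double sum in the associativity of the matrix product.\<close>

lemma (in abelian_monoid) finsum_swap:
  assumes "finite A" "finite B" "\<And>i j. i \<in> A \<Longrightarrow> j \<in> B \<Longrightarrow> f i j \<in> carrier G"
  shows "(\<Oplus>i\<in>A. \<Oplus>j\<in>B. f i j) = (\<Oplus>j\<in>B. \<Oplus>i\<in>A. f i j)"
  using assms(1,3)
proof (induction A rule: finite_induct)
  case empty
  then show ?case by simp
next
  case (insert x A)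
  then have "(\<Oplus>i\<in>insert x A. \<Oplus>j\<in>B. f i j) = (\<Oplus>j\<in>B. f x j) \<oplus> (\<Oplus>j\<in>B. \<Oplus>i\<in>A. f i j)"
    by (subst finsum_insert) (auto intro!: finsum_closed)
  also have "\<dots> = (\<Oplus>j\<in>B. f x j \<oplus> (\<Oplus>i\<in>A. f i j))"
    using insert by (intro finsum_addf[symmetric]) (auto intro!: finsum_closed)
  also have "\<dots> = (\<Oplus>j\<in>B. \<Oplus>i\<in>insert x A. f i j)"
    using insert by (intro finsum_cong') (auto intro!: finsum_closed)
  finally show ?case .
qed

text \<open>Units and inverses concern multiplication only, so this is the structure used on
  matrices. Associativity is distributivity plus an exchange of sums; in the unit laws the sums
  collapse to one term.\<close>

lemma (in semiring) monoid_mat_ring: "monoid (mat_ring R :: ('a ^ 'p ^ 'p) ring)"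
proof (rule monoidI)
  fix A B C :: "'a ^ 'p ^ 'p"
  assume "A \<in> carrier (mat_ring R)" "B \<in> carrier (mat_ring R)" "C \<in> carrier (mat_ring R)"
  then have c: "A $ i $ j \<in> carrier R" "B $ i $ j \<in> carrier R" "C $ i $ j \<in> carrier R" for i j
    by (auto simp: mat_ring_def)
  have "(\<Oplus>k\<in>UNIV. (\<Oplus>l\<in>UNIV. A $ i $ l \<otimes> B $ l $ k) \<otimes> C $ k $ j) =
        (\<Oplus>l\<in>UNIV. A $ i $ l \<otimes> (\<Oplus>k\<in>UNIV. B $ l $ k \<otimes> C $ k $ j))" for i j
  proof -
    have "(\<Oplus>k\<in>UNIV. (\<Oplus>l\<in>UNIV. A $ i $ l \<otimes> B $ l $ k) \<otimes> C $ k $ j) =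
          (\<Oplus>k\<in>UNIV. \<Oplus>l\<in>UNIV. A $ i $ l \<otimes> (B $ l $ k \<otimes> C $ k $ j))"
      by (intro finsum_cong') (auto simp: finsum_ldistr c m_assoc intro!: finsum_closed)
    also have "\<dots> = (\<Oplus>l\<in>UNIV. \<Oplus>k\<in>UNIV. A $ i $ l \<otimes> (B $ l $ k \<otimes> C $ k $ j))"
      by (intro finsum_swap) (auto simp: c)
    also have "\<dots> = (\<Oplus>l\<in>UNIV. A $ i $ l \<otimes> (\<Oplus>k\<in>UNIV. B $ l $ k \<otimes> C $ k $ j))"
      by (intro finsum_cong') (auto simp: finsum_rdistr c intro!: finsum_closed)
    finally show ?thesis .
  qed
  then show "(A \<otimes>\<^bsub>mat_ring R\<^esub> B) \<otimes>\<^bsub>mat_ring R\<^esub> C = A \<otimes>\<^bsub>mat_ring R\<^esub> (B \<otimes>\<^bsub>mat_ring R\<^esub> C)"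
    by (simp add: mat_ring_def vec_eq_iff)
next
  fix A :: "'a ^ 'p ^ 'p"
  assume "A \<in> carrier (mat_ring R)"
  then have c: "A $ i $ j \<in> carrier R" for i j by (auto simp: mat_ring_def)
  have "(\<Oplus>k\<in>UNIV. (if i = k then \<one> else \<zero>) \<otimes> A $ k $ j) =
        (\<Oplus>k\<in>UNIV. if i = k then A $ k $ j else \<zero>)" for i j
    by (intro finsum_cong') (auto simp: c)
  then show "\<one>\<^bsub>mat_ring R\<^esub> \<otimes>\<^bsub>mat_ring R\<^esub> A = A"
    by (simp add: mat_ring_def vec_eq_iff finsum_singleton c)
  have "(\<Oplus>k\<in>UNIV. A $ i $ k \<otimes> (if k = j then \<one> else \<zero>)) =
        (\<Oplus>k\<in>UNIV. if k = j then A $ i $ k else \<zero>)" for i j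
    by (intro finsum_cong') (auto simp: c)
  then show "A \<otimes>\<^bsub>mat_ring R\<^esub> \<one>\<^bsub>mat_ring R\<^esub> = A"
    by (simp add: mat_ring_def vec_eq_iff add.finprod_singleton_swap c)
qed (auto simp: mat_ring_def intro!: finsum_closed)

definition map_mat :: "('a \<Rightarrow> 'b) \<Rightarrow> 'a ^ 'p ^ 'p \<Rightarrow> 'b ^ 'p ^ 'p" where
  "map_mat h A = (\<chi> i j. h (A $ i $ j))"

text \<open>Each entry of a product is a finite sum of products, and \<open>h\<close> commutes with
  both operations. Since \<open>hom\<close> says nothing about the unit, that is a separate
  lemma.\<close>

lemma (in ring_hom_ring) map_mat_hom: "map_mat h \<in> hom (mat_ring R) (mat_ring S)"
  by (rule homI)
    (auto simp: map_mat_def mat_ring_def vec_eq_iff comp_def Pi_def cong: S.finsum_cong)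

lemma (in ring_hom_ring) map_mat_one: "map_mat h \<one>\<^bsub>mat_ring R\<^esub> = \<one>\<^bsub>mat_ring S\<^esub>"
  by (simp add: map_mat_def mat_ring_def vec_eq_iff)

lemma hom_Units:
  assumes "h \<in> hom G H" "h \<one>\<^bsub>G\<^esub> = \<one>\<^bsub>H\<^esub>" "x \<in> Units G"
  shows "h x \<in> Units H"
proof -
  obtain y where y: "x \<in> carrier G" "y \<in> carrier G" "y \<otimes>\<^bsub>G\<^esub> x = \<one>\<^bsub>G\<^esub>" "x \<otimes>\<^bsub>G\<^esub> y = \<one>\<^bsub>G\<^esub>"
    using assms(3) by (auto simp: Units_def)
  then have "h y \<otimes>\<^bsub>H\<^esub> h x = \<one>\<^bsub>H\<^esub>" "h x \<otimes>\<^bsub>H\<^esub> h y = \<one>\<^bsub>H\<^esub>"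
    using hom_mult[OF assms(1), of x y] hom_mult[OF assms(1), of y x] assms(2) by simp_all
  then show ?thesis
    using y(1,2) hom_in_carrier[OF assms(1)] by (auto simp: Units_def)
qed

text \<open>Both \<open>f\<close> and \<open>g\<close> send the products of \<open>x\<close> and
  \<open>y\<close>, in either order, to the unit, which is also the image of the unit. Joint
  injectivity then makes \<open>y\<close> a two-sided inverse of \<open>x\<close>.\<close>

lemma inverse_from_jointly_injective_homs:
  assumes "monoid G" "monoid H" "f \<in> hom G H" "g \<in> hom G H"
    and one: "f \<one>\<^bsub>G\<^esub> = \<one>\<^bsub>H\<^esub>" "g \<one>\<^bsub>G\<^esub> = \<one>\<^bsub>H\<^esub>"
    and inj: "\<And>u v. f u = f v \<Longrightarrow> g u = g v \<Longrightarrow> u = v"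
    and c: "x \<in> carrier G" "y \<in> carrier G"
    and u: "f x \<in> Units H" "g x \<in> Units H"
    and i: "f y = inv\<^bsub>H\<^esub> f x" "g y = inv\<^bsub>H\<^esub> g x"
  shows "x \<in> Units G" "inv\<^bsub>G\<^esub> x = y"
proof -
  interpret G: monoid G by fact
  interpret H: monoid H by fact
  have "x \<otimes>\<^bsub>G\<^esub> y = \<one>\<^bsub>G\<^esub>" "y \<otimes>\<^bsub>G\<^esub> x = \<one>\<^bsub>G\<^esub>"
    by (rule inj; simp add: hom_mult[OF assms(3)] hom_mult[OF assms(4)] c one u i)+
  then show "x \<in> Units G" "inv\<^bsub>G\<^esub> x = y"
    using c G.inv_char by (auto simp: Units_def)
qed

text \<open>Substitution of the real number \<open>s\<close> for j: since k = ij, the coefficient of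
  k is absorbed into that of i. The parameter \<open>s\<close> covers both square roots of
  \<beta>.\<close>

definition eval_j :: "real \<Rightarrow> tessarine \<Rightarrow> tessarine" where
  "eval_j s x = Tess (re x + s * im_j x) (im_i x + s * im_k x) 0 0"

lemma cring_alpha_complex: "cring (alpha_complex \<alpha> \<beta>)"
proof -
  interpret T: cring "tessarines \<alpha> \<beta>" by (rule cring_tessarines)
  \<comment> \<open>This brings the ring into the shape \<open>R\<lparr>carrier := H\<rparr>\<close>
    that \<open>subcring_iff\<close> speaks of.\<close>
  have "alpha_complex \<alpha> \<beta> = tessarines \<alpha> \<beta> \<lparr>carrier := carrier (alpha_complex \<alpha> \<beta>)\<rparr>"
    by (simp add: alpha_complex_def)
  then show ?thesis
    using subcring_alpha_complex[of \<alpha> \<beta>] T.subcring_iff[of "carrier (alpha_complex \<alpha> \<beta>)"]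
    by (metis subcringE(1))
qed

text \<open>Substituting \<open>s\<close> for j respects multiplication because \<open>s\<close>
  satisfies the defining relation of j, namely that its square is \<beta>.\<close>

lemma ring_hom_ring_eval_j:
  assumes "s * s = \<beta>"
  shows "ring_hom_ring (tessarines \<alpha> \<beta>) (alpha_complex \<alpha> \<beta>) (eval_j s)"
proof (rule ring_hom_ringI)
  show "eval_j s (x \<otimes>\<^bsub>tessarines \<alpha> \<beta>\<^esub> y) =
        eval_j s x \<otimes>\<^bsub>alpha_complex \<alpha> \<beta>\<^esub> eval_j s y" for x y
    by (simp add: alpha_complex_def tessarines_def tess_mult_def eval_j_def assms[symmetric]
        algebra_simps)
qed (auto simp: cring.axioms(1) cring_tessarines cring_alpha_complex carrier_alpha_complex
      eval_j_def, auto simp: alpha_complex_def tessarines_def eval_j_def tess_defs algebra_simps)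

text \<open>The sum of the two images determines the coefficients of 1 and i, their difference
  determines \<open>s\<close> times those of j and k, and \<open>s\<close> cancels.\<close>

lemma eval_j_jointly_injective:
  assumes "s \<noteq> 0" "eval_j s x = eval_j s y" "eval_j (- s) x = eval_j (- s) y"
  shows "x = y"
proof -
  have "s * im_j x = s * im_j y" "s * im_k x = s * im_k y" "re x = re y" "im_i x = im_i y"
    using assms(2,3) unfolding eval_j_def tessarine.inject by linarith+
  then show ?thesis using assms(1) by (simp add: tessarine.expand)
qed

lemma map_mat_eval_j_jointly_injective:
  assumes "s \<noteq> 0" "map_mat (eval_j s) A = map_mat (eval_j s) B"
    "map_mat (eval_j (- s)) A = map_mat (eval_j (- s)) B"
  shows "A = B"
  using assms eval_j_jointly_injective[OF assms(1)] by (simp add: map_mat_def vec_eq_iff)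

text \<open>For \<open>s\<close> equal to plus or minus \<open>sqrt \<beta>\<close> the right-hand
  sides are the two components singled out by \<open>w_decomposition_iff\<close>.\<close>

lemma map_mat_eval_j:
  "map_mat (eval_j s) X = part_a X + s *\<^sub>R part_b X"
  by (simp add: vec_eq_iff map_mat_def eval_j_def part_a_def part_b_def tess_i_def tess_defs)

text \<open>Evaluation fixes \<alpha>-complex entries, so j = \<open>s\<close> turns
  \<open>Z\<close> into C + (Xs - C) = Xs, and j = \<open>- s\<close> turns it into C - (Xs - C) =
  2C - Xs = Xd. The theorem applies this to the inverses of its own \<open>Xs\<close> and
  \<open>Xd\<close>.\<close>

lemma map_mat_eval_j_inverse_formula:
  fixes Xs Xd :: "tessarine ^ 'p ^ 'p"
  assumes "s \<noteq> 0"
    and "Xs \<in> carrier (mat_ring (alpha_complex \<alpha> \<beta>))"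
    and "Xd \<in> carrier (mat_ring (alpha_complex \<alpha> \<beta>))"
  defines "C \<equiv> (1 / 2) *\<^sub>R (Xs + Xd)"
  defines "Z \<equiv> C + mat_smult (tessarines \<alpha> \<beta>) ((1 / s) *\<^sub>R (Xs - C)) tess_j"
  shows "map_mat (eval_j s) Z = Xs" "map_mat (eval_j (- s)) Z = Xd"
proof -
  have c: "im_j (Xs $ r $ c) = 0" "im_k (Xs $ r $ c) = 0"
    "im_j (Xd $ r $ c) = 0" "im_k (Xd $ r $ c) = 0" for r c
    using assms(2,3) by (auto simp: mat_ring_def carrier_alpha_complex)
  show "map_mat (eval_j s) Z = Xs" "map_mat (eval_j (- s)) Z = Xd"
    unfolding Z_def C_def using assms(1)
    by (auto simp: vec_eq_iff map_mat_def eval_j_def mat_smult_def tessarines_def tess_mult_def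
        tess_j_def tess_defs c add_divide_distrib diff_divide_distrib right_diff_distrib
        intro!: tessarine.expand)
qed

theorem proposition2:
  fixes \<alpha> \<beta> :: real
    and X Xs Xd :: "tessarine ^ 'p ^ 'p"
  assumes "\<alpha> \<noteq> 0" and "\<beta> > 0"
    and "X \<in> carrier (mat_ring (tessarines \<alpha> \<beta>))"
    and "Xs \<in> carrier (mat_ring (alpha_complex \<alpha> \<beta>))"
    and "Xd \<in> carrier (mat_ring (alpha_complex \<alpha> \<beta>))"
    and "X = mat_smult (tessarines \<alpha> \<beta>) Xs (w1 \<beta>) + mat_smult (tessarines \<alpha> \<beta>) Xd (w2 \<beta>)"
  shows "(X \<in> Units (mat_ring (tessarines \<alpha> \<beta>)) \<longleftrightarrow>
            Xs \<in> Units (mat_ring (alpha_complex \<alpha> \<beta>)) \<and>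
            Xd \<in> Units (mat_ring (alpha_complex \<alpha> \<beta>)))
       \<and> (X \<in> Units (mat_ring (tessarines \<alpha> \<beta>)) \<longrightarrow>
            (let Xs' = inv\<^bsub>mat_ring (alpha_complex \<alpha> \<beta>)\<^esub> Xs;
                 Xd' = inv\<^bsub>mat_ring (alpha_complex \<alpha> \<beta>)\<^esub> Xd;
                 C = (1 / 2) *\<^sub>R (Xs' + Xd');
                 D = (1 / sqrt \<beta>) *\<^sub>R (Xs' - C)
             in inv\<^bsub>mat_ring (tessarines \<alpha> \<beta>)\<^esub> X =
                  C + mat_smult (tessarines \<alpha> \<beta>) D tess_j))"
proof -
  let ?T = "mat_ring (tessarines \<alpha> \<beta>) :: (tessarine ^ 'p ^ 'p) ring"
  let ?A = "mat_ring (alpha_complex \<alpha> \<beta>) :: (tessarine ^ 'p ^ 'p) ring"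
  define s where "s = sqrt \<beta>"
  have s: "s \<noteq> 0" "s * s = \<beta>" "- s * - s = \<beta>" using assms(2) by (simp_all add: s_def)
  interpret T: cring "tessarines \<alpha> \<beta>" by (rule cring_tessarines)
  interpret A: cring "alpha_complex \<alpha> \<beta>" by (rule cring_alpha_complex)
  interpret TM: monoid ?T by (rule T.monoid_mat_ring)
  interpret AM: monoid ?A by (rule A.monoid_mat_ring)
  interpret P: ring_hom_ring "tessarines \<alpha> \<beta>" "alpha_complex \<alpha> \<beta>" "eval_j s"
    by (rule ring_hom_ring_eval_j[OF s(2)])
  interpret N: ring_hom_ring "tessarines \<alpha> \<beta>" "alpha_complex \<alpha> \<beta>" "eval_j (- s)"
    by (rule ring_hom_ring_eval_j[OF s(3)])
  have X: "map_mat (eval_j s) X = Xs" "map_mat (eval_j (- s)) X = Xd"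
    using w_decomposition_iff[OF assms(2,4,5), of X] assms(6)
    by (simp_all add: map_mat_eval_j s_def)
  \<comment> \<open>As \<open>inv\<close> is total, \<open>C\<close> and \<open>Z\<close> can be
    fixed before invertibility is known; their properties are derived only for units
    \<open>Xs\<close> and \<open>Xd\<close>.\<close>
  define C where "C = (1 / 2) *\<^sub>R (inv\<^bsub>?A\<^esub> Xs + inv\<^bsub>?A\<^esub> Xd)"
  define Z where "Z = C + mat_smult (tessarines \<alpha> \<beta>) ((1 / s) *\<^sub>R (inv\<^bsub>?A\<^esub> Xs - C)) tess_j"
  have units: "Xs \<in> Units ?A \<and> Xd \<in> Units ?A" if "X \<in> Units ?T"
    using hom_Units[OF P.map_mat_hom P.map_mat_one that]
      hom_Units[OF N.map_mat_hom N.map_mat_one that] by (simp add: X)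
  have inverse: "X \<in> Units ?T \<and> inv\<^bsub>?T\<^esub> X = Z" if u: "Xs \<in> Units ?A" "Xd \<in> Units ?A"
  proof -
    have Z: "map_mat (eval_j s) Z = inv\<^bsub>?A\<^esub> Xs" "map_mat (eval_j (- s)) Z = inv\<^bsub>?A\<^esub> Xd"
      unfolding Z_def C_def
      by (rule map_mat_eval_j_inverse_formula[OF s(1) AM.Units_inv_closed AM.Units_inv_closed]; fact u)+
    have "Z \<in> carrier ?T" by (simp add: mat_ring_def tessarines_def)
    \<comment> \<open>The placeholder postpones joint injectivity. Rewriting with \<open>X\<close>
      and \<open>Z\<close> turns the conditions on the images of \<open>Z\<close> into reflexive
      equations.\<close>
    note inverse_from_jointly_injective_homs[where f = "map_mat (eval_j s)" and x = X
        and g = "map_mat (eval_j (- s))", OF TM.monoid_axioms AM.monoid_axioms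
        P.map_mat_hom N.map_mat_hom P.map_mat_one N.map_mat_one _ assms(3) this, unfolded X Z,
        OF map_mat_eval_j_jointly_injective[OF s(1)] u refl refl]
    then show ?thesis by iprover
  qed
  show ?thesis
  proof (intro conjI iffI impI)
    assume "X \<in> Units ?T"
    then show "let Xs' = inv\<^bsub>?A\<^esub> Xs; Xd' = inv\<^bsub>?A\<^esub> Xd; C = (1 / 2) *\<^sub>R (Xs' + Xd');
        D = (1 / sqrt \<beta>) *\<^sub>R (Xs' - C)
      in inv\<^bsub>?T\<^esub> X = C + mat_smult (tessarines \<alpha> \<beta>) D tess_j"
      unfolding Let_def using inverse[THEN conjunct2] units
      unfolding Z_def C_def s_def by iprover
  qed (use units inverse in iprover)+
qed

end
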